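(* Let $n \ge 3$, let $G=K_n$ be the complete graph of order $n$, and let $f_0: V(G_1) \rightarrow V(G_2)$ be a constant function. Then $\dim(C(K_n, f_0)) = 2n-3$.
   Context: For a connected graph $H$, a set $S \subseteq V(H)$ is a resolving set if for every two distinct vertices $x,y$ of $H$ there is $s \in S$ with $d_H(x,s) \neq d_H(y,s)$; the metric dimension $\dim(H)$ is the minimum cardinality of a resolving set of $H$. Given a graph $G$, let $G_1$ and $G_2$ be disjoint copies of $G$ and let $f: V(G_1)\to V(G_2)$ be a function. The functigraph $C(G,f)$ is the graph with vertex set $V(G_1)\cup V(G_2)$ and edge set $E(G_1)\cup E(G_2)\cup\{uv \mid u \in V(G_1),\ v=f(u)\}$. *)

theory Defs
  imports "Graph_Theory.Graph_Theory"
begin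

text \<open>
  Simple graphs are symmetric loop-free digraphs whose arcs are pairs of vertices
  (locale \<^locale>\<open>pair_graph\<close>); an undirected edge $uv$ is the two arcs $(u,v)$ and $(v,u)$.
\<close>

definition graph_dist :: "'a pair_pre_digraph \<Rightarrow> 'a \<Rightarrow> 'a \<Rightarrow> ereal" where
  "graph_dist H u v = wf_digraph.\<mu> (with_proj H) (\<lambda>_. 1) u v"

definition resolving_set :: "'a pair_pre_digraph \<Rightarrow> 'a set \<Rightarrow> bool" where
  "resolving_set H S \<longleftrightarrow> S \<subseteq> pverts H \<and>
     (\<forall>x\<in>pverts H. \<forall>y\<in>pverts H. x \<noteq> y \<longrightarrow>
        (\<exists>s\<in>S. graph_dist H x s \<noteq> graph_dist H y s))"

text \<open>
  Meaningful for finite connected graphs, where the whole vertex set is a finite resolving set,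
  so that the minimum is attained.
\<close>

definition metric_dim :: "'a pair_pre_digraph \<Rightarrow> nat" where
  "metric_dim H = (LEAST k. \<exists>S. resolving_set H S \<and> finite S \<and> card S = k)"

text \<open>
  The disjoint copies $G_1$ and $G_2$ are the images of $G$ under \<^const>\<open>Inl\<close> and \<^const>\<open>Inr\<close>.
  A function from $V(G_1)$ to $V(G_2)$ is given by the function that it induces on $V(G)$.
\<close>

definition functigraph :: "'a pair_pre_digraph \<Rightarrow> ('a \<Rightarrow> 'a) \<Rightarrow> ('a + 'a) pair_pre_digraph" where
  "functigraph G f =
     \<lparr> pverts = Inl ` pverts G \<union> Inr ` pverts G,
       parcs = {(Inl u, Inl v) | u v. (u, v) \<in> parcs G}
             \<union> {(Inr u, Inr v) | u v. (u, v) \<in> parcs G}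
             \<union> {(Inl u, Inr (f u)) | u. u \<in> pverts G}
             \<union> {(Inr (f u), Inl u) | u. u \<in> pverts G} \<rparr>"

lemma pair_graph_functigraph:
  assumes "pair_graph G" and "f ` pverts G \<subseteq> pverts G"
  shows "pair_graph (functigraph G f)"
proof -
  interpret pair_graph G by fact
  let ?H = "functigraph G f"
  have fin: "finite (pverts ?H)"
    by (simp add: functigraph_def pair_finite_verts)
  have wf: "fst e \<in> pverts ?H \<and> snd e \<in> pverts ?H" if "e \<in> parcs ?H" for e
    using that assms(2) by (auto simp: functigraph_def dest: in_arcsD1 in_arcsD2)
  have "parcs ?H \<subseteq> pverts ?H \<times> pverts ?H"
    using wf by (auto simp: mem_Times_iff)
  then have fina: "finite (parcs ?H)"
    using fin by (meson finite_SigmaI finite_subset)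
  have symG: "(v, u) \<in> parcs G" if "(u, v) \<in> parcs G" for u v
    using that pair_sym_arcs by (auto simp: symmetric_def sym_def)
  have "symmetric (with_proj ?H)"
    unfolding symmetric_def by (rule symI) (auto simp: functigraph_def dest: symG)
  moreover have "fst e \<noteq> snd e" if "e \<in> parcs ?H" for e
    using that by (auto simp: functigraph_def dest: pair_no_loops)
  ultimately show ?thesis
    using wf fin fina by unfold_locales auto
qed

lemma strongly_connected_functigraph:
  assumes "pair_graph G" and "f ` pverts G \<subseteq> pverts G" and "strongly_connected (with_proj G)"
  shows "strongly_connected (with_proj (functigraph G f))"
proof -
  interpret G: pair_graph G by fact
  let ?H = "with_proj (functigraph G f)"
  interpret H: pair_graph "functigraph G f"
    by (rule pair_graph_functigraph) fact+
  have copy: "h u \<rightarrow>\<^sup>*\<^bsub>?H\<^esub> h v"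
    if reach: "u \<rightarrow>\<^sup>*\<^bsub>with_proj G\<^esub> v" and h: "h = Inl \<or> h = Inr" for u v h
    using reach
  proof (induction rule: G.reachable_induct)
    case base
    then show ?case using h
      by (intro H.reachable_refl) (auto simp: functigraph_def)
  next
    case (step x y)
    then have "(h x, h y) \<in> parcs (functigraph G f)"
      using h by (auto simp: functigraph_def)
    with step.IH show ?case by (rule H.reachable_adj_trans)
  qed
  have cross: "Inl u \<rightarrow>\<^sup>*\<^bsub>?H\<^esub> Inr (f u)" "Inr (f u) \<rightarrow>\<^sup>*\<^bsub>?H\<^esub> Inl u" if "u \<in> pverts G" for u
    by (rule H.reachable_adjI, use that in \<open>simp add: functigraph_def\<close>)+
  have conn: "u \<rightarrow>\<^sup>*\<^bsub>with_proj G\<^esub> v" if "u \<in> pverts G" "v \<in> pverts G" for u v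
    using assms(3) that by (simp add: strongly_connected_def)
  have "x \<rightarrow>\<^sup>*\<^bsub>?H\<^esub> y" if x: "x \<in> verts ?H" and y: "y \<in> verts ?H" for x y
  proof -
    have lr: "Inl u \<rightarrow>\<^sup>*\<^bsub>?H\<^esub> Inr v" "Inr v \<rightarrow>\<^sup>*\<^bsub>?H\<^esub> Inl u" if u: "u \<in> pverts G" and v: "v \<in> pverts G" for u v
    proof -
      have fu: "f u \<in> pverts G" using assms(2) u by blast
      have "Inr (f u) \<rightarrow>\<^sup>*\<^bsub>?H\<^esub> Inr v" "Inr v \<rightarrow>\<^sup>*\<^bsub>?H\<^esub> Inr (f u)"
        by (rule copy[OF conn[OF fu v]], simp) (rule copy[OF conn[OF v fu]], simp)
      then show "Inl u \<rightarrow>\<^sup>*\<^bsub>?H\<^esub> Inr v" "Inr v \<rightarrow>\<^sup>*\<^bsub>?H\<^esub> Inl u"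
        using cross[OF u] by (blast intro: H.reachable_trans)+
    qed
    have same: "Inl u \<rightarrow>\<^sup>*\<^bsub>?H\<^esub> Inl v" "Inr u \<rightarrow>\<^sup>*\<^bsub>?H\<^esub> Inr v" if "u \<in> pverts G" "v \<in> pverts G" for u v
      by (rule copy[OF conn[OF that]], simp)+
    obtain u where u: "u \<in> pverts G" "x = Inl u \<or> x = Inr u"
      using x by (auto simp: functigraph_def)
    obtain v where v: "v \<in> pverts G" "y = Inl v \<or> y = Inr v"
      using y by (auto simp: functigraph_def)
    show ?thesis
      using u(2) v(2) same[OF u(1) v(1)] lr[OF u(1) v(1)] lr[OF v(1) u(1)] by (elim disjE) simp_all
  qed
  moreover have "verts ?H \<noteq> {}"
    using assms(3) by (auto simp: strongly_connected_def functigraph_def)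
  ultimately show ?thesis by (simp add: strongly_connected_def)
qed

end

theory Submission
  imports Defs
begin

text \<open>
  The functigraph is the union of a clique of order \<open>n + 1\<close> (the first copy of \<open>K\<^sub>n\<close> together with
  the image point \<open>c\<close>) and a clique of order \<open>n\<close> (the second copy), glued at \<open>c\<close>. Deleting \<open>c\<close>
  leaves two classes of mutually indistinguishable vertices, of sizes \<open>n\<close> and \<open>n - 1\<close>; a resolving
  set misses at most one vertex of each class, whence the lower bound \<open>(n - 1) + (n - 2)\<close>.
  Conversely, leaving out \<open>c\<close> and one vertex of each class gives a resolving set, since the three
  missing vertices are told apart by one remaining vertex from each class.
\<close>

context wf_digraph
begin

lemma awalk_cost_unit: "awalk_cost (\<lambda>_. 1) p = real (length p)"
  by (induction p) simp_all

lemma unit_mu_self: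
  assumes "u \<in> verts G"
  shows "\<mu> (\<lambda>_. 1) u u = 0"
proof (rule antisym)
  show "\<mu> (\<lambda>_. 1) u u \<le> 0"
    using min_cost_le_walk_cost[of u "[]" u "\<lambda>_. 1"] assms
    by (simp add: awalk_Nil_iff zero_ereal_def)
  show "0 \<le> \<mu> (\<lambda>_. 1) u u"
    unfolding \<mu>_def by (intro INF_greatest) (simp add: awalk_cost_unit)
qed

lemma unit_mu_adj:
  assumes "u \<noteq> v" and "u \<rightarrow> v"
  shows "\<mu> (\<lambda>_. 1) u v = 1"
proof (rule antisym)
  obtain e where "e \<in> arcs G" "tail G e = u" "head G e = v"
    using assms(2) by (auto simp: arcs_ends_conv)
  then have "awalk u [e] v"
    using arc_implies_awalk by blast
  then show "\<mu> (\<lambda>_. 1) u v \<le> 1"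
    using min_cost_le_walk_cost[of u "[e]" v "\<lambda>_. 1"] by (simp add: one_ereal_def)
  have "1 \<le> length p" if "awalk u p v" for p
    using that assms(1) by (cases p) (auto simp: awalk_Nil_iff)
  then show "1 \<le> \<mu> (\<lambda>_. 1) u v"
    unfolding \<mu>_def by (intro INF_greatest) (simp add: awalk_cost_unit one_ereal_def)
qed

text \<open>The walk through \<open>w\<close> has length 2. The empty walk would force
  \<open>u = v\<close>, and a single arc would make the two vertices adjacent.\<close>

lemma unit_mu_two:
  assumes "u \<noteq> v" and "\<not> u \<rightarrow> v" and "u \<rightarrow> w" and "w \<rightarrow> v"
  shows "\<mu> (\<lambda>_. 1) u v = 2"
proof (rule antisym)
  obtain e where e: "e \<in> arcs G" "tail G e = u" "head G e = w"
    using assms(3) by (auto simp: arcs_ends_conv)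
  obtain e' where e': "e' \<in> arcs G" "tail G e' = w" "head G e' = v"
    using assms(4) by (auto simp: arcs_ends_conv)
  have "awalk u [e, e'] v"
    using e e' by (auto simp: awalk_simps)
  then show "\<mu> (\<lambda>_. 1) u v \<le> 2"
    using min_cost_le_walk_cost[of u "[e, e']" v "\<lambda>_. 1"] by simp
  have "2 \<le> length p" if p: "awalk u p v" for p
  proof (rule ccontr)
    assume "\<not> 2 \<le> length p"
    then consider "p = []" | a where "p = [a]"
      by (cases p; cases "tl p") auto
    then show False
      using p assms(1,2) by cases (auto simp: awalk_simps arcs_ends_conv)
  qed
  then have "ereal 2 \<le> \<mu> (\<lambda>_. 1) u v"
    unfolding \<mu>_def by (intro INF_greatest) (simp add: awalk_cost_unit)
  then show "2 \<le> \<mu> (\<lambda>_. 1) u v"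
    by simp
qed

end

text \<open>If two distinct members of \<open>T\<close> were outside \<open>S\<close>, every
  landmark in \<open>S\<close> would differ from both and hence see them at equal distance. So
  \<open>S\<close> misses at most one member.\<close>

lemma card_twins_le_resolving:
  assumes res: "resolving_set H S" and fin: "finite T" and TV: "T \<subseteq> pverts H"
    and twins: "\<And>x y s. \<lbrakk>x \<in> T; y \<in> T; s \<in> pverts H; s \<noteq> x; s \<noteq> y\<rbrakk>
      \<Longrightarrow> graph_dist H x s = graph_dist H y s"
  shows "card T - 1 \<le> card (S \<inter> T)"
proof -
  have "x = y" if "x \<in> T - S" "y \<in> T - S" for x y
    using that res TV twins unfolding resolving_set_def by (metis DiffD1 DiffD2 subsetD)
  then have "card (T - S) \<le> 1"
    using fin by (simp add: card_le_Suc0_iff_eq)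
  moreover have "card T = card (S \<inter> T) + card (T - S)"
    using fin by (metis Int_commute card_Int_Diff)
  ultimately show ?thesis by simp
qed

text \<open>Adjacency means lying in a common clique. Whole ranges may describe the cliques because
  \<open>x\<close> and \<open>y\<close> are already known to be vertices.\<close>

lemma graph_dist_functigraph_complete:
  fixes G :: "'a pair_pre_digraph"
  assumes K: "complete_digraph n (with_proj G)"
    and c: "c \<in> pverts G" and f: "\<forall>v\<in>pverts G. f v = c"
    and x: "x \<in> pverts (functigraph G f)" and y: "y \<in> pverts (functigraph G f)"
  shows "graph_dist (functigraph G f) x y =
    (if x = y then 0
     else if {x, y} \<subseteq> insert (Inr c) (range Inl) \<or> {x, y} \<subseteq> range Inr then 1 else 2)"
proof -
  have "pair_graph G"
    using K by (rule pair_graphI_complete)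
  then interpret H: pair_graph "functigraph G f"
    by (rule pair_graph_functigraph) (use c f in auto)
  have arcs: "parcs G = {(u, v). u \<in> pverts G \<and> v \<in> pverts G \<and> u \<noteq> v}"
    using K by (auto simp: complete_digraph_pair_def)
  have verts: "pverts (functigraph G f) = Inl ` pverts G \<union> Inr ` pverts G"
    by (simp add: functigraph_def)
  have adj: "u \<rightarrow>\<^bsub>with_proj (functigraph G f)\<^esub> v \<longleftrightarrow> u \<noteq> v \<and>
      ({u, v} \<subseteq> insert (Inr c) (range Inl) \<or> {u, v} \<subseteq> range Inr)"
    if "u \<in> pverts (functigraph G f)" "v \<in> pverts (functigraph G f)" for u v
    using that c f unfolding verts by (auto simp: functigraph_def arcs)
  have cV: "Inr c \<in> pverts (functigraph G f)"
    using c by (simp add: verts)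
  consider "x = y" | "x \<noteq> y" "x \<rightarrow>\<^bsub>with_proj (functigraph G f)\<^esub> y"
    | "x \<noteq> y" "\<not> x \<rightarrow>\<^bsub>with_proj (functigraph G f)\<^esub> y" by blast
  then show ?thesis
  proof cases
    case 1
    then show ?thesis
      using H.unit_mu_self x by (simp add: graph_dist_def)
  next
    case 2
    then show ?thesis
      using H.unit_mu_adj adj[OF x y] by (simp add: graph_dist_def)
  next
    case 3
    \<comment> \<open>\<open>Inr c\<close> lies in both cliques, so a non-adjacent pair of distinct
      vertices avoids it, and both members are its neighbours.\<close>
    have "x \<rightarrow>\<^bsub>with_proj (functigraph G f)\<^esub> Inr c" "Inr c \<rightarrow>\<^bsub>with_proj (functigraph G f)\<^esub> y"
      using 3 adj[OF x y] adj[OF x cV] adj[OF cV y] x y unfolding verts by auto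
    then have "graph_dist (functigraph G f) x y = 2"
      using H.unit_mu_two 3 by (simp add: graph_dist_def)
    then show ?thesis
      using 3 adj[OF x y] by simp
  qed
qed

theorem theorem3p4:
  fixes G :: "'a pair_pre_digraph" and f0 :: "'a \<Rightarrow> 'a" and c :: 'a and n :: nat
  assumes "n \<ge> 3"
    and "complete_digraph n (with_proj G)"
    and "c \<in> pverts G"
    and "\<forall>v\<in>pverts G. f0 v = c"
  shows "metric_dim (functigraph G f0) = 2 * n - 3"
proof -
  let ?V = "pverts G" and ?H = "functigraph G f0"
  let ?A = "Inl ` ?V :: ('a + 'a) set" and ?B = "Inr ` (?V - {c}) :: ('a + 'a) set"
  have finV: "finite ?V" and cardV: "card ?V = n"
    using assms(2) by (auto simp: complete_digraph_pair_def)
  have verts: "pverts ?H = Inl ` ?V \<union> Inr ` ?V"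
    by (simp add: functigraph_def)
  have dist: "graph_dist ?H (Inl u) (Inl v) = (if u = v then 0 else 1)"
    "graph_dist ?H (Inr u) (Inr v) = (if u = v then 0 else 1)"
    "graph_dist ?H (Inl u) (Inr v) = (if v = c then 1 else 2)"
    "graph_dist ?H (Inr v) (Inl u) = (if v = c then 1 else 2)"
    if "u \<in> ?V" "v \<in> ?V" for u v
    using that
    by (subst graph_dist_functigraph_complete[OF assms(2-4)]; auto simp: verts)+
  have cardA: "card ?A = n" and cardB: "card ?B = n - 1"
    using finV cardV assms(3) by (simp_all add: card_image)
  have lower: "2 * n - 3 \<le> card S" if res: "resolving_set ?H S" and finS: "finite S" for S
  proof -
    \<comment> \<open>Vertices of \<open>?A\<close> are twins: each is at distance 1 from the rest
      of \<open>?A\<close> and from \<open>Inr c\<close>, and at distance 2 from \<open>?B\<close>.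
      The class \<open>?B\<close> behaves symmetrically.\<close>
    have "card ?A - 1 \<le> card (S \<inter> ?A)"
      by (rule card_twins_le_resolving[OF res]) (use finV in \<open>auto simp: verts dist split: if_splits\<close>)
    moreover have "card ?B - 1 \<le> card (S \<inter> ?B)"
      by (rule card_twins_le_resolving[OF res]) (use finV in \<open>auto simp: verts dist split: if_splits\<close>)
    moreover have "card (S \<inter> ?A) + card (S \<inter> ?B) \<le> card S"
    proof -
      have "card (S \<inter> ?A) + card (S \<inter> ?B) = card (S \<inter> ?A \<union> S \<inter> ?B)"
        using finS by (intro card_Un_disjoint[symmetric]) auto
      also have "\<dots> \<le> card S"
        using finS by (intro card_mono) auto
      finally show ?thesis .
    qed
    ultimately show ?thesis
      using cardA cardB by linarith
  qed
  have "?V \<noteq> {c}"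
    using assms(1) cardV by auto
  then obtain b where b: "b \<in> ?V" "b \<noteq> c" using assms(3) by blast
  have "card (?V - {c, b}) = n - 2"
    using b assms(3) finV cardV by (simp add: card_Diff_subset)
  \<comment> \<open>Here n \<ge> 3 leaves room for a third vertex \<open>d\<close>, so that the
    second copy still contributes a landmark once \<open>Inr c\<close> and \<open>Inr b\<close> are
    left out.\<close>
  then have "card (?V - {c, b}) \<noteq> 0"
    using assms(1) by linarith
  then have "?V - {c, b} \<noteq> {}"
    by (metis card.empty)
  then obtain d where d: "d \<in> ?V" "d \<noteq> c" "d \<noteq> b" by blast
  let ?S = "Inl ` (?V - {c}) \<union> Inr ` (?V - {c, b}) :: ('a + 'a) set"
  have "resolving_set ?H ?S"
    unfolding resolving_set_def
  proof (intro conjI ballI impI)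
    show "?S \<subseteq> pverts ?H"
      by (auto simp: verts)
    fix x y
    assume x: "x \<in> pverts ?H" and y: "y \<in> pverts ?H" and "x \<noteq> y"
    show "\<exists>s\<in>?S. graph_dist ?H x s \<noteq> graph_dist ?H y s"
    proof (cases "x \<in> ?S \<or> y \<in> ?S")
      case True
      \<comment> \<open>A landmark separates itself from every other vertex, being the only one at
        distance 0 from itself.\<close>
      have "graph_dist ?H x x \<noteq> graph_dist ?H y x" "graph_dist ?H x y \<noteq> graph_dist ?H y y"
        using \<open>x \<noteq> y\<close> x y by (auto simp: verts dist split: if_splits)
      with True show ?thesis by blast
    next
      case False
      then have "x \<in> {Inl c, Inr b, Inr c}" "y \<in> {Inl c, Inr b, Inr c}"
        using x y by (auto simp: verts)
      \<comment> \<open>The distances to \<open>Inl b\<close> and \<open>Inr d\<close> are (1, 2)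
        for \<open>Inl c\<close>, (2, 1) for \<open>Inr b\<close> and (1, 1) for
        \<open>Inr c\<close>.\<close>
      then have "graph_dist ?H x (Inl b) \<noteq> graph_dist ?H y (Inl b) \<or>
          graph_dist ?H x (Inr d) \<noteq> graph_dist ?H y (Inr d)"
        using \<open>x \<noteq> y\<close> x y b d assms(3) by (auto simp: dist)
      moreover have "Inl b \<in> ?S" "Inr d \<in> ?S"
        using b d by auto
      ultimately show ?thesis by blast
    qed
  qed
  moreover have "finite ?S"
    using finV by simp
  moreover have "card ?S = 2 * n - 3"
  proof -
    have "card ?S = card (?V - {c}) + card (?V - {c, b})"
      using finV by (subst card_Un_disjoint) (auto simp: card_image)
    also have "\<dots> = (n - 1) + (n - 2)"
      using \<open>card (?V - {c, b}) = n - 2\<close> finV cardV assms(3) by simp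
    finally show ?thesis
      using assms(1) by simp
  qed
  ultimately show ?thesis
    unfolding metric_dim_def by (intro Least_equality) (use lower in blast)+
qed

end
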